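(* Let $C\subset\mathbb{R}^2$ be an unbounded open convex set and let $P\subset\mathbb{R}^2$ be a finite set of points in the plane. Then every $3$-fold covering of $P$ with translates of $C$ can be split into two coverings of $P$.
   Context: A family $\mathcal{C}$ of subsets of $\mathbb{R}^2$ is an $m$-fold covering of a set $P\subseteq\mathbb{R}^2$ if every point of $P$ belongs to at least $m$ members of $\mathcal{C}$; a $1$-fold covering is called a covering. An $m$-fold covering $\mathcal{C}$ of $P$ can be split into two coverings of $P$ if $\mathcal{C}$ can be partitioned into two subfamilies, each of which is a covering of $P$. *)

theory Defs
  imports "HOL-Analysis.Analysis"
begin

text \<open>Families of sets are indexed families \<open>F i\<close>, \<open>i \<in> I\<close>, so that the same set may occur several
  times and is then counted with multiplicity. A plain set \<open>\<C>\<close> of sets is the special case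
  \<open>I = \<C>\<close>, \<open>F = (\<lambda>S. S)\<close>. Families need not be finite; since \<open>card\<close> is \<open>0\<close> on infinite
  sets, points lying in infinitely many members are treated separately.\<close>

definition fold_covering :: "nat \<Rightarrow> 'i set \<Rightarrow> ('i \<Rightarrow> (real^2) set) \<Rightarrow> (real^2) set \<Rightarrow> bool" where
  "fold_covering m I F P \<longleftrightarrow>
     (\<forall>p\<in>P. infinite {i \<in> I. p \<in> F i} \<or> m \<le> card {i \<in> I. p \<in> F i})"

definition covering :: "'i set \<Rightarrow> ('i \<Rightarrow> (real^2) set) \<Rightarrow> (real^2) set \<Rightarrow> bool" where
  "covering I F P \<longleftrightarrow> fold_covering 1 I F P"

definition splits_into_two_coverings ::
    "'i set \<Rightarrow> ('i \<Rightarrow> (real^2) set) \<Rightarrow> (real^2) set \<Rightarrow> bool" where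
  "splits_into_two_coverings I F P \<longleftrightarrow>
     (\<exists>I1 I2. I1 \<union> I2 = I \<and> I1 \<inter> I2 = {} \<and> covering I1 F P \<and> covering I2 F P)"

definition is_translate :: "(real^2) set \<Rightarrow> (real^2) set \<Rightarrow> bool" where
  "is_translate C S \<longleftrightarrow> (\<exists>t. S = (\<lambda>x. t + x) ` C)"

end

theory Submission
  imports Defs
begin

text \<open>
  An unbounded open convex set \<open>C\<close> is mapped into itself by all translations in some direction
  \<open>v\<close> (lemma \<open>unbounded_convex_recession_direction\<close>). Let \<open>\<ell>\<close> be a linear functional with kernel
  spanned by \<open>v\<close>; in suitable coordinates \<open>v\<close> points upwards, \<open>\<ell>\<close> is the horizontal
  coordinate and, apart from degenerate cases such as strips, \<open>C\<close> is the region above a convex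
  curve. Of two translates \<open>s + C\<close> and \<open>t + C\<close> with
  \<open>\<ell> s \<le> \<ell> t\<close>, everything that lies only in the first is then to the left of everything that
  lies only in the second (lemma \<open>translate_differences_separated\<close>), because the difference of the
  two boundary curves is monotone.

  This property is symmetric in points and translates. So, listing the translates in the order of
  \<open>\<ell> t\<close> and assigning to each point \<open>p\<close> the set of the translates that contain it, one obtains
  a family of subsets of a linear order such that \<open>\<ell> p \<le> \<ell> q\<close> forces the elements
  belonging to the set of \<open>p\<close> alone to be smaller than those belonging to the set of \<open>q\<close> alone.
  What remains is to colour the elements of the linear order with two colours so that no set of the
  family is monochromatic, provided that each has at least three elements.

  For the colouring, call an element skipped if some set of the family misses it but has elements
  on both of its sides. Every set has an unskipped element (lemma \<open>exists_unskipped_element\<close>),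
  so there is an inclusion-minimal set \<open>H\<close> of unskipped elements that meets every set. No
  set \<open>A\<close> with three elements \<open>a < b < c\<close> lies inside \<open>H\<close>: by minimality, some set \<open>B\<close> meets \<open>H\<close>
  only in \<open>b\<close>, and a further element of \<open>B\<close>, which is outside \<open>A\<close>, can neither lie between \<open>a\<close>
  and \<open>c\<close>, as the two sets would interleave, nor beyond one of them, which \<open>B\<close> would then skip. Hence
  \<open>H\<close> and its complement are the two colour classes.
\<close>

section \<open>Colouring families whose set differences are ordered\<close>

definition precedes :: "'a::linorder set \<Rightarrow> 'a set \<Rightarrow> bool" where
  "precedes A B \<longleftrightarrow> (\<forall>x \<in> A - B. \<forall>y \<in> B - A. x < y)"

definition skips :: "'a::linorder set \<Rightarrow> 'a \<Rightarrow> bool" where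
  "skips B a \<longleftrightarrow> a \<notin> B \<and> (\<exists>x\<in>B. x < a) \<and> (\<exists>y\<in>B. a < y)"

lemma precedesD: "precedes A B \<Longrightarrow> x \<in> A \<Longrightarrow> x \<notin> B \<Longrightarrow> y \<in> B \<Longrightarrow> y \<notin> A \<Longrightarrow> x < y"
  unfolding precedes_def by blast

text \<open>
  The least element of \<open>S r\<close> cannot be skipped by a later set, so there is a largest element \<open>a\<close> of
  \<open>S r\<close> that no later set skips. If an earlier set \<open>S s\<close> skipped \<open>a\<close>, its next element \<open>b\<close> after \<open>a\<close>
  would belong to \<open>S r\<close> and so be skipped by a later set; comparing that set with \<open>S s\<close> shows that it
  skips \<open>a\<close> as well.
\<close>
lemma exists_unskipped_element:
  fixes S :: "'r \<Rightarrow> 'a::linorder set" and pos :: "'r \<Rightarrow> 'b::linorder"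
  assumes ord: "\<And>s t. s \<in> R \<Longrightarrow> t \<in> R \<Longrightarrow> pos s \<le> pos t \<Longrightarrow> precedes (S s) (S t)"
    and r: "r \<in> R" and fin: "finite (S r)" and ne: "S r \<noteq> {}"
  shows "\<exists>a\<in>S r. \<forall>s\<in>R. \<not> skips (S s) a"
proof -
  define N where "N = {a \<in> S r. \<forall>t\<in>R. pos r \<le> pos t \<longrightarrow> \<not> skips (S t) a}"
  have finN: "finite N" using fin by (simp add: N_def)
  have "Min (S r) \<in> N"
  proof -
    have "\<not> skips (S t) (Min (S r))" if t: "t \<in> R" "pos r \<le> pos t" for t
    proof
      assume "skips (S t) (Min (S r))"
      then obtain x where x: "x \<in> S t" "x < Min (S r)" "Min (S r) \<notin> S t"
        unfolding skips_def by blast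
      have "x \<notin> S r" using x(2) Min_le[OF fin, of x] by (meson not_le)
      then have "Min (S r) < x"
        using precedesD[OF ord[OF r t]] x fin ne Min_in by metis
      then show False using x(2) by simp
    qed
    then show ?thesis using fin ne by (simp add: N_def)
  qed
  then have neN: "N \<noteq> {}" by blast
  define a where "a = Max N"
  have aN: "a \<in> N" using Max_in[OF finN neN] by (simp add: a_def)
  then have aS: "a \<in> S r"
    and a_later: "\<And>t. t \<in> R \<Longrightarrow> pos r \<le> pos t \<Longrightarrow> \<not> skips (S t) a"
    by (auto simp: N_def)
  have "\<not> skips (S s) a" if s: "s \<in> R" for s
  proof
    assume sk: "skips (S s) a"
    then have "pos s \<le> pos r" using a_later[OF s] by force
    then have prec: "precedes (S s) (S r)" by (rule ord[OF s r])
    have a_s: "a \<notin> S s" using sk by (simp add: skips_def)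
    define D where "D = {b \<in> S s. a < b}"
    have D_sub: "D \<subseteq> S r"
      using precedesD[OF prec _ _ aS a_s] by (force simp: D_def)
    have finD: "finite D" using finite_subset[OF D_sub fin] .
    have "D \<noteq> {}" using sk by (auto simp: skips_def D_def)
    define b where "b = Min D"
    have "b \<in> D" using Min_in[OF finD \<open>D \<noteq> {}\<close>] by (simp add: b_def)
    then have b: "b \<in> S s" "a < b" "b \<in> S r" using D_sub by (auto simp: D_def)
    have "b \<notin> N" using b(2) Max_ge[OF finN, of b] by (auto simp: a_def)
    then obtain t where t: "t \<in> R" "pos r \<le> pos t" "skips (S t) b"
      using b(3) by (auto simp: N_def)
    then obtain c d where c: "c \<in> S t" "c < b" and d: "d \<in> S t" "b < d" and b_t: "b \<notin> S t"
      unfolding skips_def by blast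
    have prec_st: "precedes (S s) (S t)"
      using ord[OF s t(1)] \<open>pos s \<le> pos r\<close> t(2) by (meson order_trans)
    have a_t: "a \<notin> S t" using precedesD[OF prec_st b(1) b_t _ a_s] b(2) by fastforce
    have c_s: "c \<in> S s" using precedesD[OF prec_st b(1) b_t c(1)] c(2) by fastforce
    have "\<not> a < c" using c_s c(2) Min_le[OF finD, of c] by (auto simp: D_def b_def)
    then have "c < a" using c_s a_s by (metis linorder_less_linear)
    then have "skips (S t) a" using a_t c(1) d less_trans[OF b(2) d(2)] by (auto simp: skips_def)
    then show False using a_later[OF t(1,2)] by blast
  qed
  then show ?thesis using aS by blast
qed

text \<open>
  One colour class is an inclusion-minimal transversal that uses unskipped elements only; minimality
  gives each of its elements \<open>b\<close> a set that it alone hits.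
\<close>
lemma exists_two_colouring:
  fixes S :: "'r \<Rightarrow> 'a::linorder set" and pos :: "'r \<Rightarrow> 'b::linorder"
  assumes finR: "finite R"
    and ord: "\<And>s t. s \<in> R \<Longrightarrow> t \<in> R \<Longrightarrow> pos s \<le> pos t \<Longrightarrow> precedes (S s) (S t)"
    and three: "\<And>r. r \<in> R \<Longrightarrow> 3 \<le> card (S r)"
  shows "\<exists>H. \<forall>r\<in>R. S r \<inter> H \<noteq> {} \<and> \<not> S r \<subseteq> H"
proof -
  have finS: "finite (S r)" and neS: "S r \<noteq> {}" if "r \<in> R" for r
    using three[OF that] card.infinite[of "S r"] by fastforce+
  define U where "U = {a \<in> \<Union>(S ` R). \<forall>s\<in>R. \<not> skips (S s) a}"
  have finU: "finite U" using finR finS by (simp add: U_def)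
  define T where "T = {H \<in> Pow U. \<forall>r\<in>R. S r \<inter> H \<noteq> {}}"
  have "U \<in> T"
    using exists_unskipped_element[where pos = pos and S = S and R = R, OF ord _ finS neS]
    by (fastforce simp: T_def U_def)
  moreover have "finite T" using finU by (simp add: T_def)
  ultimately obtain H where H: "H \<in> T" and H_min: "\<And>H'. H' \<in> T \<Longrightarrow> H' \<subseteq> H \<Longrightarrow> H' = H"
    using finite_has_minimal[of T] by blast
  have "\<not> S r \<subseteq> H" if r: "r \<in> R" for r
  proof
    assume sub: "S r \<subseteq> H"
    define a where "a = Min (S r)"
    define c where "c = Max (S r)"
    have ac: "a \<in> S r" "c \<in> S r" using finS[OF r] neS[OF r] by (simp_all add: a_def c_def)
    have "card {a, c} \<le> 2" by (simp add: card_insert_if)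
    then have "\<not> S r \<subseteq> {a, c}"
      using card_mono[of "{a, c}" "S r"] three[OF r] by auto
    then obtain b where b: "b \<in> S r" "b \<noteq> a" "b \<noteq> c" by blast
    have ab: "a < b" using Min_le[OF finS[OF r] b(1)] b(2) by (simp add: a_def)
    have bc: "b < c" using Max_ge[OF finS[OF r] b(1)] b(3) by (simp add: c_def)
    have "H - {b} \<notin> T" using H_min[of "H - {b}"] b(1) sub by blast
    then obtain s where s: "s \<in> R" "S s \<inter> (H - {b}) = {}"
      using H by (auto simp: T_def)
    then have bs: "b \<in> S s" using H by (auto simp: T_def)
    have "\<not> S s \<subseteq> {b}" using card_mono[of "{b}" "S s"] three[OF s(1)] by auto
    then obtain b' where b': "b' \<in> S s" "b' \<noteq> b" by blast
    have b'r: "b' \<notin> S r" using b' s(2) sub by blast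
    have as: "a \<notin> S s" and cs: "c \<notin> S s" using s(2) ac sub ab bc by blast+
    have unsk: "\<not> skips (S s) a" "\<not> skips (S s) c"
      using H s(1) ac sub by (auto simp: T_def U_def)
    have "a < b'"
      using unsk(1) as bs ab b'(1) by (metis skips_def linorder_less_linear)
    moreover have "b' < c"
      using unsk(2) cs bs bc b'(1) by (metis skips_def linorder_less_linear)
    moreover have "c < b' \<or> b' < a"
    proof (cases "pos r \<le> pos s")
      case True
      then show ?thesis using precedesD[OF ord[OF r s(1)] ac(2) cs b'(1) b'r] by blast
    next
      case False
      then show ?thesis using precedesD[OF ord[OF s(1) r] b'(1) b'r ac(1) as] by simp
    qed
    ultimately show False by auto
  qed
  moreover have "\<forall>r\<in>R. S r \<inter> H \<noteq> {}" using H by (simp add: T_def)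
  ultimately show ?thesis by blast
qed

text \<open>Translates may share the value of the functional; an injective ranking breaks these ties.\<close>
lemma exists_injective_ranking:
  fixes f :: "'a \<Rightarrow> 'b::linorder"
  assumes "finite J"
  shows "\<exists>g :: 'a \<Rightarrow> nat. inj_on g J \<and> (\<forall>i\<in>J. \<forall>j\<in>J. f i < f j \<longrightarrow> g i < g j)"
  using assms
proof (induction J rule: finite_ranking_induct[where f = f])
  case empty
  then show ?case by simp
next
  case (insert x J)
  then obtain g :: "'a \<Rightarrow> nat" where g: "inj_on g J" "\<forall>i\<in>J. \<forall>j\<in>J. f i < f j \<longrightarrow> g i < g j"
    by blast
  show ?case
  proof (cases "x \<in> J")
    case True
    then show ?thesis using g by (auto simp: insert_absorb)
  next
    case False
    obtain n where n: "\<forall>i\<in>J. g i < n"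
      using finite_nat_set_iff_bounded[of "g ` J"] insert.hyps(1) by auto
    have "inj_on (g(x := n)) (insert x J)"
      using g(1) n False by (auto simp: inj_on_def)
    moreover have "\<forall>i\<in>insert x J. \<forall>j\<in>insert x J. f i < f j \<longrightarrow> (g(x := n)) i < (g(x := n)) j"
      using g(2) n insert.hyps(2) False by (auto simp: not_less[symmetric])
    ultimately show ?thesis by blast
  qed
qed

section \<open>Translates of an unbounded convex set\<close>

text \<open>
  The direction is a limit of the directions of points of \<open>C\<close> that run off to infinity. The ray
  from \<open>x\<close> in this direction is a limit of segments of \<open>C\<close>, hence in the closure of \<open>C\<close>; starting in
  the interior, it does not leave it.
\<close>
lemma unbounded_convex_recession_direction:
  fixes C :: "'a::euclidean_space set"
  assumes "open C" "convex C" "\<not> bounded C"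
  obtains v where "v \<noteq> 0" "\<And>x c. x \<in> C \<Longrightarrow> 0 \<le> c \<Longrightarrow> x + c *\<^sub>R v \<in> C"
proof -
  have "\<exists>y\<in>C. real n < norm y" for n
    using assms(3) by (meson bounded_iff not_less)
  then obtain y where y: "\<And>n. y n \<in> C" "\<And>n. real n < norm (y n)" by metis
  define u where "u n = y n /\<^sub>R norm (y n)" for n
  have "norm (y n) > 0" for n using y(2)[of n] by (meson of_nat_0_le_iff le_less_trans)
  then have "u n \<in> sphere 0 1" for n by (simp add: u_def)
  then obtain v \<sigma> where v: "v \<in> sphere 0 1" "strict_mono \<sigma>" "(u \<circ> \<sigma>) \<longlonglongrightarrow> v"
    using compact_sphere[of "0::'a" 1] unfolding compact_def by blast
  have lim_inv: "(\<lambda>n. inverse (norm (y (\<sigma> n)))) \<longlonglongrightarrow> 0"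
  proof -
    have "filterlim (\<lambda>n. norm (y n)) at_top sequentially"
      using filterlim_at_top_mono[OF filterlim_real_sequentially] y(2)
      by (simp add: less_imp_le eventuallyI)
    then have "filterlim (\<lambda>n. norm (y (\<sigma> n))) at_top sequentially"
      using filterlim_compose filterlim_subseq[OF v(2)] by blast
    then show ?thesis by (rule tendsto_inverse_0_at_top)
  qed
  have ray_closure: "x + c *\<^sub>R v \<in> closure C" if x: "x \<in> C" and c: "0 \<le> c" for x c
  proof -
    define t where "t n = c * inverse (norm (y (\<sigma> n)))" for n
    have t_lim: "t \<longlonglongrightarrow> 0" unfolding t_def using tendsto_mult[OF tendsto_const lim_inv] by simp
    have "(1 - t n) *\<^sub>R x + t n *\<^sub>R y (\<sigma> n) = (1 - t n) *\<^sub>R x + c *\<^sub>R (u \<circ> \<sigma>) n" for n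
      by (simp add: t_def u_def)
    moreover have "(\<lambda>n. (1 - t n) *\<^sub>R x + c *\<^sub>R (u \<circ> \<sigma>) n) \<longlonglongrightarrow> (1 - 0) *\<^sub>R x + c *\<^sub>R v"
      by (intro tendsto_intros t_lim v(3))
    ultimately have lim: "(\<lambda>n. (1 - t n) *\<^sub>R x + t n *\<^sub>R y (\<sigma> n)) \<longlonglongrightarrow> x + c *\<^sub>R v"
      by simp
    have "\<forall>\<^sub>F n in sequentially. t n < 1" using t_lim by (simp add: order_tendstoD(2))
    then have "\<forall>\<^sub>F n in sequentially. (1 - t n) *\<^sub>R x + t n *\<^sub>R y (\<sigma> n) \<in> closure C"
    proof (rule eventually_mono)
      fix n assume "t n < 1"
      moreover have "0 \<le> t n" using c by (simp add: t_def)
      ultimately have "(1 - t n) *\<^sub>R x + t n *\<^sub>R y (\<sigma> n) \<in> C"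
        using assms(2) x y(1) by (simp add: convex_def)
      then show "(1 - t n) *\<^sub>R x + t n *\<^sub>R y (\<sigma> n) \<in> closure C"
        using closure_subset by blast
    qed
    then show ?thesis
      using Lim_in_closed_set[OF closed_closure _ _ lim] by simp
  qed
  have "x + c *\<^sub>R v \<in> C" if x: "x \<in> C" and c: "0 \<le> c" for x c
  proof (cases "c = 0")
    case False
    \<comment> \<open>An interior point of the segment from \<open>x\<close> to the point of the ray twice as far away.\<close>
    have "x + c *\<^sub>R v \<in> open_segment x (x + (2 * c) *\<^sub>R v)"
      unfolding in_segment using False c v(1)
      by (auto intro!: exI[of _ "1/2"] simp: algebra_simps simp flip: scaleR_add_left)
    moreover have "open_segment x (x + (2 * c) *\<^sub>R v) \<subseteq> interior C"
      using in_interior_closure_convex_segment[OF assms(2), of x] ray_closure[OF x, of "2 * c"]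
        x c assms(1) by (simp add: interior_open)
    ultimately show ?thesis using interior_subset by blast
  qed (use x in simp)
  moreover have "v \<noteq> 0" using v(1) by auto
  ultimately show ?thesis using that by blast
qed

definition cross2 :: "real^2 \<Rightarrow> real^2 \<Rightarrow> real" where
  "cross2 v x = x $ 1 * v $ 2 - x $ 2 * v $ 1"

lemma linear_cross2: "linear (cross2 v)"
  by (rule linearI) (auto simp: cross2_def algebra_simps)

lemma cross2_eq_0_imp_parallel:
  assumes "v \<noteq> 0" "cross2 v d = 0"
  shows "\<exists>c. d = c *\<^sub>R v"
proof (cases "v $ 1 = 0")
  case True
  then have "v $ 2 \<noteq> 0" using assms(1) by (auto simp: vec_eq_iff forall_2)
  then show ?thesis using assms(2) True
    by (intro exI[of _ "d $ 2 / v $ 2"]) (auto simp: vec_eq_iff forall_2 cross2_def)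
next
  case False
  then show ?thesis using assms(2)
    by (intro exI[of _ "d $ 1 / v $ 1"]) (auto simp: vec_eq_iff forall_2 cross2_def field_simps)
qed

text \<open>
  If the conclusion failed, the points \<open>q - s\<close> and \<open>p - t\<close> would lie above or below the segment
  joining \<open>q - t\<close> and \<open>p - s\<close>, where \<open>v\<close> points upwards. The four points form a parallelogram,
  so one of the first two is displaced from that segment by a nonnegative multiple of \<open>v\<close>, hence
  lies in \<open>C\<close>.
\<close>
lemma translate_differences_separated:
  fixes C :: "(real^2) set"
  assumes "convex C" and "v \<noteq> 0"
    and rec: "\<And>x c. x \<in> C \<Longrightarrow> 0 \<le> c \<Longrightarrow> x + c *\<^sub>R v \<in> C"
    and le: "cross2 v s \<le> cross2 v t"
    and p: "p - s \<in> C" "p - t \<notin> C" and q: "q - t \<in> C" "q - s \<notin> C"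
  shows "cross2 v p < cross2 v q"
proof (rule ccontr)
  assume neg: "\<not> cross2 v p < cross2 v q"
  let ?l = "cross2 v"
  note lin = linear_add[OF linear_cross2] linear_diff[OF linear_cross2] linear_scale[OF linear_cross2]
  define w where "w = ?l (p - s) - ?l (q - t)"
  \<comment> \<open>Position on the segment of the point \<open>a\<close> in line with \<open>q - s\<close>; if \<open>w = 0\<close>, all four points
    are in line with each other and an end point serves.\<close>
  define \<mu> where "\<mu> = (if w = 0 then 0 else (?l t - ?l s) / w)"
  have w: "w = (?l p - ?l q) + (?l t - ?l s)" by (simp add: w_def lin)
  then have \<mu>: "0 \<le> \<mu>" "\<mu> \<le> 1" "\<mu> * w = ?l t - ?l s"
    using neg le by (auto simp: \<mu>_def divide_simps)
  define a where "a = (1 - \<mu>) *\<^sub>R (q - t) + \<mu> *\<^sub>R (p - s)"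
  define b where "b = \<mu> *\<^sub>R (q - t) + (1 - \<mu>) *\<^sub>R (p - s)"
  have ab: "a \<in> C" "b \<in> C"
    using \<open>convex C\<close> p(1) q(1) \<mu> by (auto simp: convex_def a_def b_def)
  have "?l a = ?l (q - t) + \<mu> * w" by (simp add: a_def w_def lin algebra_simps)
  then have "?l (q - s - a) = 0" by (simp add: lin \<mu>(3))
  then obtain c where c: "q - s - a = c *\<^sub>R v"
    using cross2_eq_0_imp_parallel[OF \<open>v \<noteq> 0\<close>] by blast
  have "a + b = (q - s) + (p - t)" by (simp add: a_def b_def algebra_simps)
  then have "p - t - b = (- c) *\<^sub>R v" using c by (simp add: algebra_simps)
  then have "p - t = b + (- c) *\<^sub>R v" by (metis diff_add_cancel add.commute)
  moreover have "q - s = a + c *\<^sub>R v" using c by (metis diff_add_cancel add.commute)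
  ultimately show False
    using rec[OF ab(1), of c] rec[OF ab(2), of "- c"] p(2) q(2) by (cases "0 \<le> c") auto
qed

section \<open>Splitting the covering\<close>

text \<open>
  It suffices to keep \<open>m\<close> members for each point of \<open>P\<close>. A splitting of the finite subfamily extends
  to the whole family arbitrarily, since adding members to a covering leaves it a covering.
\<close>
lemma fold_covering_finite_subfamily:
  assumes "finite P" "fold_covering m I F P"
  obtains J where "J \<subseteq> I" "finite J" "\<And>p. p \<in> P \<Longrightarrow> m \<le> card {i \<in> J. p \<in> F i}"
proof -
  have "\<exists>T \<subseteq> {i \<in> I. p \<in> F i}. finite T \<and> card T = m" if "p \<in> P" for p
  proof (cases "finite {i \<in> I. p \<in> F i}")
    case True
    then have "m \<le> card {i \<in> I. p \<in> F i}" using assms(2) that by (auto simp: fold_covering_def)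
    then show ?thesis by (meson obtain_subset_with_card_n)
  next
    case False
    then show ?thesis using infinite_arbitrarily_large by blast
  qed
  then obtain T where T: "\<And>p. p \<in> P \<Longrightarrow> T p \<subseteq> {i \<in> I. p \<in> F i} \<and> finite (T p) \<and> card (T p) = m"
    by metis
  define J where "J = \<Union>(T ` P)"
  have "finite J" using assms(1) T by (auto simp: J_def)
  moreover have "J \<subseteq> I" using T by (auto simp: J_def)
  moreover have "m \<le> card {i \<in> J. p \<in> F i}" if "p \<in> P" for p
  proof -
    have "T p \<subseteq> {i \<in> J. p \<in> F i}" using T[OF that] that by (auto simp: J_def)
    then show ?thesis using card_mono[of "{i \<in> J. p \<in> F i}" "T p"] T[OF that] \<open>finite J\<close> by auto
  qed
  ultimately show ?thesis using that by blast
qed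

lemma coveringI:
  assumes "\<And>p. p \<in> P \<Longrightarrow> \<exists>i\<in>I. p \<in> F i"
  shows "covering I F P"
  unfolding covering_def fold_covering_def
proof
  fix p assume "p \<in> P"
  then have "{i \<in> I. p \<in> F i} \<noteq> {}" using assms by blast
  then show "infinite {i \<in> I. p \<in> F i} \<or> 1 \<le> card {i \<in> I. p \<in> F i}"
    by (metis One_nat_def Suc_leI card_gt_0_iff)
qed

theorem theorem6:
  fixes C P :: "(real^2) set" and I :: "'i set" and F :: "'i \<Rightarrow> (real^2) set"
  assumes "open C" and "convex C" and "\<not> bounded C"
    and "finite P"
    and "\<And>i. i \<in> I \<Longrightarrow> is_translate C (F i)"
    and "fold_covering 3 I F P"
  shows "splits_into_two_coverings I F P"
proof -
  obtain v where v: "v \<noteq> 0" "\<And>x c. x \<in> C \<Longrightarrow> 0 \<le> c \<Longrightarrow> x + c *\<^sub>R v \<in> C"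
    using unbounded_convex_recession_direction[OF assms(1-3)] by blast
  obtain \<tau> where \<tau>: "\<And>i. i \<in> I \<Longrightarrow> F i = (\<lambda>x. \<tau> i + x) ` C"
    using assms(5) unfolding is_translate_def by metis
  have mem: "p \<in> F i \<longleftrightarrow> p - \<tau> i \<in> C" if "i \<in> I" for p i
    using \<tau>[OF that] by (auto simp: image_iff intro!: bexI[of _ "p - \<tau> i"])
  obtain J where J: "J \<subseteq> I" "finite J" "\<And>p. p \<in> P \<Longrightarrow> 3 \<le> card {i \<in> J. p \<in> F i}"
    using fold_covering_finite_subfamily[OF assms(4,6)] by blast
  obtain g :: "'i \<Rightarrow> nat" where g: "inj_on g J"
      "\<And>i j. i \<in> J \<Longrightarrow> j \<in> J \<Longrightarrow> cross2 v (\<tau> i) < cross2 v (\<tau> j) \<Longrightarrow> g i < g j"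
    using exists_injective_ranking[OF J(2), of "\<lambda>i. cross2 v (\<tau> i)"] by blast
  define S where "S p = g ` {i \<in> J. p \<in> F i}" for p
  have "precedes (S p) (S q)" if pq: "cross2 v p \<le> cross2 v q" for p q
    unfolding precedes_def
  proof (intro ballI)
    fix x y assume "x \<in> S p - S q" "y \<in> S q - S p"
    then obtain i j where i: "i \<in> J" "x = g i" "p \<in> F i" "q \<notin> F i"
      and j: "j \<in> J" "y = g j" "q \<in> F j" "p \<notin> F j"
      by (auto simp: S_def)
    have ij: "p - \<tau> i \<in> C" "q - \<tau> i \<notin> C" "q - \<tau> j \<in> C" "p - \<tau> j \<notin> C"
      using i j mem J(1) by blast+
    have "cross2 v (\<tau> i) < cross2 v (\<tau> j)"
      using translate_differences_separated[OF assms(2) v, of "\<tau> j" "\<tau> i" q p] ij pq by fastforce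
    then show "x < y" using g(2) i j by blast
  qed
  moreover have "3 \<le> card (S p)" if "p \<in> P" for p
    using J(3)[OF that] card_image[OF inj_on_subset[OF g(1)], of "{i \<in> J. p \<in> F i}"]
    by (auto simp: S_def)
  ultimately obtain H where H: "\<And>p. p \<in> P \<Longrightarrow> S p \<inter> H \<noteq> {} \<and> \<not> S p \<subseteq> H"
    using exists_two_colouring[OF assms(4), of "cross2 v" S] by blast
  define I1 where "I1 = {i \<in> J. g i \<in> H}"
  have "covering I1 F P"
    using H by (intro coveringI) (fastforce simp: I1_def S_def)
  moreover have "covering (I - I1) F P"
  proof (rule coveringI)
    fix p assume "p \<in> P"
    then obtain i where "i \<in> J" "p \<in> F i" "g i \<notin> H" using H by (fastforce simp: S_def)
    then show "\<exists>i\<in>I - I1. p \<in> F i" using J(1) by (auto simp: I1_def)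
  qed
  ultimately show ?thesis
    unfolding splits_into_two_coverings_def using J(1)
    by (intro exI[of _ I1] exI[of _ "I - I1"]) (auto simp: I1_def)
qed

end
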